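(* Let $1\le r<\infty$ and let $(\alpha,s)$ be admissible. Then the formula defining $G^{\alpha}_{s,r}$ (with the stated branches) defines an analytic function on the whole upper half-plane $\mathbb{C}_+$ which maps $\mathbb{C}_+$ into the lower half-plane $\mathbb{C}_-$, is univalent on $\mathbb{C}_+$, and is the Cauchy transform $G_\mu(z)=\int_{\mathbb{R}}\frac{\mu(dx)}{z-x}$ of a Borel probability measure $\mu$ on $\mathbb{R}$. (This measure is denoted $\mu^{\alpha}_{s,r}$.)
   Context: Branch conventions: for $w\in\mathbb{C}\setminus[0,\infty)$ and $p\in\{\alpha,1/\alpha\}$, $w^{p}:=e^{p\log_{(1)}w}$, where $\log_{(1)}$ is the branch of the logarithm with imaginary part in $(0,2\pi)$; for $w\in\mathbb{C}\setminus(-\infty,0]$, $w^{1/r}:=e^{\frac1r\operatorname{Log}w}$ with the principal logarithm (imaginary part in $(-\pi,\pi)$); $r^{1/\alpha}>0$. For $0<\alpha\le2$, $r>0$, $s\in\mathbb{C}\setminus\{0\}$, \[ G^{\alpha}_{s,r}(z)=-r^{1/\alpha}\left(\frac{1-\big(1-s(-\tfrac1z)^{\alpha}\big)^{1/r}}{s}\right)^{1/\alpha}. \] A pair $(\alpha,s)$ with $s\in\mathbb{C}\setminus\{0\}$ and $\arg s\in(-\pi,\pi]$ is called admissible if either (1) $0<\alpha\le1$ and $(1-\alpha)\pi\le\arg s\le\pi$, or (2) $1<\alpha\le2$ and $0\le\arg s\le(2-\alpha)\pi$. *)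

theory Defs
  imports "HOL-Probability.Probability"
begin

(* log_(1): branch of the logarithm with imaginary part in (0, 2 pi), on C \ [0,inf).
   For w not in [0,inf), -w is not in (-inf,0], so Ln(-w) has Im in (-pi,pi). *)
definition log1 :: "complex \<Rightarrow> complex" where
  "log1 w = Ln (- w) + \<i> * of_real pi"

definition pow1 :: "real \<Rightarrow> complex \<Rightarrow> complex" where
  "pow1 p w = exp (of_real p * log1 w)"

definition powP :: "real \<Rightarrow> complex \<Rightarrow> complex" where
  "powP q w = exp (of_real q * Ln w)"

definition G_fun :: "real \<Rightarrow> complex \<Rightarrow> real \<Rightarrow> complex \<Rightarrow> complex" where
  "G_fun \<alpha> s r z =
     - of_real (r powr (1 / \<alpha>)) *
       pow1 (1 / \<alpha>) ((1 - powP (1 / r) (1 - s * pow1 \<alpha> (- 1 / z))) / s)"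

definition admissible :: "real \<Rightarrow> complex \<Rightarrow> bool" where
  "admissible \<alpha> s \<longleftrightarrow> s \<noteq> 0 \<and>
     ((0 < \<alpha> \<and> \<alpha> \<le> 1 \<and> (1 - \<alpha>) * pi \<le> Arg s \<and> Arg s \<le> pi) \<or>
      (1 < \<alpha> \<and> \<alpha> \<le> 2 \<and> 0 \<le> Arg s \<and> Arg s \<le> (2 - \<alpha>) * pi))"

end

theory Submission
  imports Defs "HOL-Complex_Analysis.Complex_Analysis"
begin

text \<open>
  In logarithmic coordinates the univalent map is a composition of affine maps of horizontal strips
  with the self-map of the strip induced by \<open>f u = 1 - (1 - u) powr (1 / r)\<close>. As \<open>r \<ge> 1\<close>, the
  derivative of \<open>f\<close> has nonnegative imaginary part on the upper half-plane, so integrating along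
  the segment from \<open>0\<close> to \<open>u\<close> shows that \<open>f u / u\<close> does, too. Hence \<open>f\<close> moves
  arguments towards \<open>\<pi>\<close>. Admissibility says that the sector swept out by
  \<open>s * (- 1 / z) powr \<alpha>\<close> contains the negative axis and lies within \<open>(0, 2 \<pi>)\<close>, so \<open>f\<close>
  preserves it; undoing the affine map returns to the strip of width \<open>\<pi>\<close>. Since \<open>f' 0 = 1 / r\<close>,
  also \<open>z * G z \<longlongrightarrow> 1\<close> at infinity.

  Any holomorphic \<open>F\<close> on the upper half-plane with \<open>Im F \<le> 0\<close> and \<open>z * F z \<longlongrightarrow> 1\<close> is the
  Cauchy transform of a probability measure: on the line \<open>Im z = \<delta>\<close>, Cauchy's formula for \<open>c\<close>
  and for its reflection combine to show that \<open>F\<close> is the transform of the density \<open>- Im F / \<pi>\<close>;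
  these densities are tight as \<open>\<delta>\<close> tends to \<open>0\<close>, and Helly's theorem supplies the measure.
\<close>

subsection \<open>Cauchy transforms of probability measures\<close>

lemma integrable_inverse_one_plus_square: "integrable lborel (\<lambda>x::real. inverse (1 + x\<^sup>2))"
  using Sinc_Integral.integrable_inverse_1_plus_square
  by (simp add: set_integrable_def einterval_eq)

lemma integrable_quadratic_decay:
  fixes f :: "real \<Rightarrow> complex"
  assumes cont: "continuous_on UNIV f"
    and decay: "\<And>x. M \<le> \<bar>x\<bar> \<Longrightarrow> norm (f x) \<le> C / x\<^sup>2"
  shows "integrable lborel f"
proof -
  define N where "N = max 1 M"
  have "compact (f ` {-N..N})"
    by (intro compact_continuous_image continuous_on_subset[OF cont]) auto
  then obtain B where B: "\<And>x. x \<in> {-N..N} \<Longrightarrow> norm (f x) \<le> B"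
    by (meson bounded_iff compact_imp_bounded imageI)
  \<comment> \<open>Each entry serves one range: \<open>\<bar>B\<bar> * (1 + N\<^sup>2)\<close> for
    |x| at most N, and \<open>2 * \<bar>C\<bar>\<close> outside, where x^2 is at least 1 and so 1 +
    x^2 is at most 2 x^2.\<close>
  define K where "K = max (2 * \<bar>C\<bar>) (\<bar>B\<bar> * (1 + N\<^sup>2))"
  have bound: "norm (f x) \<le> K * inverse (1 + x\<^sup>2)" for x
  proof (cases "\<bar>x\<bar> \<le> N")
    case True
    then have "x\<^sup>2 \<le> N\<^sup>2" by (metis abs_le_square_iff abs_of_nonneg abs_ge_zero order_trans)
    have "norm (f x) \<le> \<bar>B\<bar>" using B[of x] True by (auto simp: abs_le_iff)
    then have "norm (f x) * (1 + x\<^sup>2) \<le> \<bar>B\<bar> * (1 + N\<^sup>2)"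
      using \<open>x\<^sup>2 \<le> N\<^sup>2\<close> by (intro mult_mono) auto
    also have "\<dots> \<le> K" by (simp add: K_def)
    finally show ?thesis by (simp add: divide_inverse [symmetric] pos_le_divide_eq add_pos_nonneg)
  next
    case False
    then have "1 \<le> \<bar>x\<bar>" "M \<le> \<bar>x\<bar>" by (auto simp: N_def)
    then have "1 \<le> x\<^sup>2" using one_le_power[of "\<bar>x\<bar>" 2] by simp
    have "norm (f x) * (1 + x\<^sup>2) \<le> (C / x\<^sup>2) * (1 + x\<^sup>2)"
      using decay[OF \<open>M \<le> \<bar>x\<bar>\<close>] by (intro mult_right_mono) auto
    also have "\<dots> \<le> (\<bar>C\<bar> / x\<^sup>2) * (2 * x\<^sup>2)"
      using \<open>1 \<le> x\<^sup>2\<close> by (intro mult_mono divide_right_mono) auto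
    also have "\<dots> = 2 * \<bar>C\<bar>"
      using \<open>1 \<le> x\<^sup>2\<close> by auto
    also have "\<dots> \<le> K" by (simp add: K_def)
    finally show ?thesis by (simp add: divide_inverse [symmetric] pos_le_divide_eq add_pos_nonneg)
  qed
  have "integrable lborel (\<lambda>x. K * inverse (1 + x\<^sup>2))"
    using integrable_inverse_one_plus_square by simp
  moreover have "f \<in> borel_measurable lborel"
    using cont by (simp add: borel_measurable_continuous_onI)
  ultimately show ?thesis
  proof (rule Bochner_Integration.integrable_bound)
    show "AE x in lborel. norm (f x) \<le> norm (K * inverse (1 + x\<^sup>2))"
      using bound by (intro always_eventually allI) (metis abs_ge_self order_trans real_norm_def)
  qed
qed

text \<open>Contour integration over rectangles yields integrals over [-R, R] only. Dominated
  convergence, with the norm of \<open>f\<close> as majorant, passes from them to the Lebesgue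
  integral over the line.\<close>

lemma tendsto_integral_symmetric_intervals:
  fixes f :: "real \<Rightarrow> complex"
  assumes "integrable lborel f"
  shows "(\<lambda>n. integral {- real n..real n} f) \<longlonglongrightarrow> (\<integral>x. f x \<partial>lborel)"
proof -
  have "(\<lambda>n. \<integral>x. indicator {- real n..real n} x *\<^sub>R f x \<partial>lborel) \<longlonglongrightarrow> (\<integral>x. f x \<partial>lborel)"
  proof (rule integral_dominated_convergence[where w="\<lambda>x. norm (f x)"])
    show "AE x in lborel. (\<lambda>n. indicator {- real n..real n} x *\<^sub>R f x) \<longlonglongrightarrow> f x"
    proof (rule always_eventually, intro allI, rule tendsto_eventually)
      fix x :: real
      obtain N :: nat where "\<bar>x\<bar> \<le> real N" using real_arch_simple by blast
      then show "\<forall>\<^sub>F n in sequentially. indicator {- real n..real n} x *\<^sub>R f x = f x"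
        by (intro eventually_sequentiallyI[of N]) (auto simp: indicator_def abs_le_iff)
    qed
  qed (use assms in \<open>auto simp: indicator_def\<close>)
  moreover have "(\<integral>x. indicator {- real n..real n} x *\<^sub>R f x \<partial>lborel) = integral {- real n..real n} f" for n
  proof -
    have "set_integrable lborel {- real n..real n} f"
      unfolding set_integrable_def using assms by (intro integrable_mult_indicator) auto
    from set_borel_integral_eq_integral(2)[OF this] show ?thesis
      by (simp add: set_lebesgue_integral_def)
  qed
  ultimately show ?thesis by simp
qed

section \<open>Cauchy's formula on a half-plane and boundary densities\<close>

lemma contour_integral_rectpath_split:
  assumes cont: "continuous_on (path_image (rectpath a b)) f"
    and int: "(f has_contour_integral V) (rectpath a b)"
  defines "a' \<equiv> Complex (Re b) (Im a)" and "b' \<equiv> Complex (Re a) (Im b)"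
  shows "V = contour_integral (linepath a a') f + contour_integral (linepath a' b) f +
             contour_integral (linepath b b') f + contour_integral (linepath b' a) f"
proof -
  have "path_image (rectpath a b) =
      closed_segment a a' \<union> closed_segment a' b \<union> closed_segment b b' \<union> closed_segment b' a"
    by (simp add: rectpath_def Let_def path_image_join Un_assoc a'_def b'_def)
  then have "f contour_integrable_on linepath a a'" "f contour_integrable_on linepath a' b"
    "f contour_integrable_on linepath b b'" "f contour_integrable_on linepath b' a"
    using cont by (auto intro!: contour_integrable_continuous_linepath intro: continuous_on_subset)
  moreover have "V = contour_integral (rectpath a b) f"
    using int by (simp add: contour_integral_unique)
  ultimately show ?thesis
    unfolding rectpath_def Let_def by (simp flip: a'_def b'_def)
qed

text \<open>Close [-R, R] by a rectangle in the upper half-plane. The integrand is O(1/R^2) on the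
  other three sides, whose total length is 4 R, so only the residue at \<open>c\<close> survives,
  and only if \<open>c\<close> lies above the axis. The margin \<open>\<delta>\<close> puts the axis
  inside the domain of holomorphy.\<close>

lemma half_plane_Cauchy_integral:
  fixes H :: "complex \<Rightarrow> complex"
  assumes \<delta>: "0 < \<delta>" and hol: "H holomorphic_on {z. - \<delta> < Im z}"
    and decay: "\<forall>z. 0 \<le> Im z \<longrightarrow> R0 \<le> norm z \<longrightarrow> norm (H z) \<le> C / norm z"
    and c: "Im c \<noteq> 0"
  shows "integrable lborel (\<lambda>x. H (of_real x) / (of_real x - c))"
    and "(\<integral>x. H (of_real x) / (of_real x - c) \<partial>lborel) = (if 0 < Im c then 2 * pi * \<i> * H c else 0)"
proof -
  let ?g = "\<lambda>w. H w / (w - c)"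
  \<comment> \<open>The entry \<open>2 * norm c + 1\<close> gives |z - c| >= |z| / 2 for |z| >=
    \<open>R1\<close> and keeps \<open>c\<close> off every rectangle boundary used below.\<close>
  define R1 where "R1 = Max {1, R0, 2 * norm c + 1}"
  have R1: "1 \<le> R1" "R0 \<le> R1" "2 * norm c + 1 \<le> R1" by (auto simp: R1_def)
  have contH: "continuous_on {z. - \<delta> < Im z} H"
    using hol by (rule holomorphic_on_imp_continuous_on)
  have C0: "0 \<le> C"
    using decay[rule_format, of "of_real R1"] R1 by (smt (verit) Im_complex_of_real divide_less_0_iff norm_ge_zero norm_of_real)
  have gdecay: "norm (?g z) \<le> 2 * C / (norm z)\<^sup>2" if "0 \<le> Im z" "R1 \<le> norm z" for z
  proof -
    have "norm z / 2 \<le> norm (z - c)"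
      using norm_triangle_ineq2[of z c] R1 that by simp
    moreover have "0 < norm z" using R1 that by linarith
    ultimately have "norm (?g z) \<le> (C / norm z) / (norm z / 2)"
      unfolding norm_divide using R1 that decay[rule_format, of z] C0 by (intro frac_le) auto
    then show ?thesis by (simp add: power2_eq_square mult.commute)
  qed
  show int: "integrable lborel (\<lambda>x. ?g (of_real x))"
  proof (rule integrable_quadratic_decay)
    show "continuous_on UNIV (\<lambda>x. ?g (complex_of_real x))"
      using c \<delta> by (intro continuous_intros continuous_on_compose2[OF contH]) auto
    show "norm (?g (of_real x)) \<le> 2 * C / x\<^sup>2" if "R1 \<le> \<bar>x\<bar>" for x
      using gdecay[of "of_real x"] that by simp
  qed
  define V where "V = (if 0 < Im c then 2 * pi * \<i> * H c else 0)"
  have rect: "norm (integral {- R..R} (\<lambda>x. ?g (of_real x)) - V) \<le> 8 * C / R" if R: "R1 \<le> R" for R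
  proof -
    define a b where "a = Complex (- R) 0" and "b = Complex R R"
    define a' b' where "a' = Complex (Re b) (Im a)" and "b' = Complex (Re a) (Im b)"
    have R0: "0 < R" "norm c < R" using R R1 norm_ge_zero[of c] by linarith+
    have pth: "valid_path (rectpath a b)" "pathfinish (rectpath a b) = pathstart (rectpath a b)"
      "path_image (rectpath a b) \<subseteq> cbox a b"
      using path_image_rectpath_subset_cbox[of a b] R0 by (auto simp: a_def b_def)
    have notc: "c \<notin> path_image (rectpath a b)"
      using c R0 abs_Re_le_cmod[of c] abs_Im_le_cmod[of c]
      by (auto simp: path_image_rectpath_cbox_minus_box a_def b_def in_cbox_complex_iff in_box_complex_iff)
    have gint: "(?g has_contour_integral V) (rectpath a b)"
    proof (cases "0 < Im c")
      case True
      have "c \<in> box a b"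
        using True R0 abs_Re_le_cmod[of c] abs_Im_le_cmod[of c]
        by (auto simp: a_def b_def in_box_complex_iff)
      then have "winding_number (rectpath a b) c = 1" by (rule winding_number_rectpath)
      moreover have "open {z. - \<delta> < Im z}" by (simp add: open_halfspace_Im_gt)
      moreover have "convex {z. - \<delta> < Im z}" by (simp add: convex_halfspace_Im_gt)
      ultimately show ?thesis
        using Cauchy_integral_formula_convex_simple[OF _ hol, of c "rectpath a b"] pth notc \<delta> True
        by (force simp: V_def interior_open in_cbox_complex_iff a_def b_def)
    next
      case False
      \<comment> \<open>Here \<open>c\<close> is below the axis. Cutting the half-plane at the
        height of \<open>c\<close> keeps it convex, removes the pole and still contains the
        rectangle.\<close>
      define S where "S = {z. max (- \<delta>) (Im c) < Im z}"
      have "?g holomorphic_on S"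
        by (intro holomorphic_intros holomorphic_on_subset[OF hol]) (auto simp: S_def)
      moreover have "convex S" unfolding S_def by (rule convex_halfspace_Im_gt)
      moreover have "path_image (rectpath a b) \<subseteq> S"
        using pth(3) c False \<delta> by (force simp: S_def in_cbox_complex_iff a_def b_def)
      ultimately show ?thesis
        using Cauchy_theorem_convex_simple[of ?g S "rectpath a b"] pth False by (simp add: V_def)
    qed
    have contg: "continuous_on (path_image (rectpath a b)) ?g"
      using pth(3) notc \<delta>
      by (intro continuous_intros continuous_on_subset[OF contH])
        (force simp: in_cbox_complex_iff a_def b_def)+
    have "V = contour_integral (linepath a a') ?g + contour_integral (linepath a' b) ?g +
             contour_integral (linepath b b') ?g + contour_integral (linepath b' a) ?g"
      unfolding a'_def b'_def by (rule contour_integral_rectpath_split[OF contg gint])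
    moreover have "contour_integral (linepath a a') ?g = integral {- R..R} (\<lambda>x. ?g (of_real x))"
      using contour_integral_linepath_Reals_eq[of a a' ?g] R0
      by (simp add: a_def a'_def b_def complex_is_Real_iff)
    moreover have side: "norm (contour_integral (linepath p q) ?g) \<le> 2 * C / R\<^sup>2 * norm (q - p)"
      if pq: "\<And>z. z \<in> closed_segment p q \<Longrightarrow> 0 \<le> Im z \<and> R \<le> norm z" for p q
    proof (rule contour_integral_bound_linepath)
      show "?g contour_integrable_on linepath p q"
      proof (intro contour_integrable_continuous_linepath continuous_intros continuous_on_subset[OF contH])
        show "closed_segment p q \<subseteq> {z. - \<delta> < Im z}" using pq \<delta> by force
        show "\<forall>z\<in>closed_segment p q. z - c \<noteq> 0" using pq R0 by force
      qed
      show "0 \<le> 2 * C / R\<^sup>2" using C0 by simp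
      show "norm (?g z) \<le> 2 * C / R\<^sup>2" if "z \<in> closed_segment p q" for z
      proof -
        have "norm (?g z) \<le> 2 * C / (norm z)\<^sup>2" using pq[OF that] R by (intro gdecay) auto
        also have "\<dots> \<le> 2 * C / R\<^sup>2" using pq[OF that] C0 R0 by (intro frac_le power_mono) auto
        finally show ?thesis .
      qed
    qed
    moreover have "norm (contour_integral (linepath a' b) ?g) \<le> 2 * C / R\<^sup>2 * R"
    proof -
      have "norm (b - a') = R" using R0 by (simp add: a'_def a_def b_def cmod_def)
      moreover have "0 \<le> Im z \<and> R \<le> norm z" if "z \<in> closed_segment a' b" for z
        using that R0 abs_Re_le_cmod[of z]
        by (auto simp: a'_def a_def b_def closed_segment_same_Re closed_segment_eq_real_ivl)
      ultimately show ?thesis using side[of a' b] by simp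
    qed
    moreover have "norm (contour_integral (linepath b b') ?g) \<le> 2 * C / R\<^sup>2 * (2 * R)"
    proof -
      have "norm (b' - b) = 2 * R" using R0 by (simp add: b'_def a_def b_def cmod_eq_Re)
      moreover have "0 \<le> Im z \<and> R \<le> norm z" if "z \<in> closed_segment b b'" for z
        using that R0 abs_Im_le_cmod[of z]
        by (auto simp: b'_def a_def b_def closed_segment_same_Im closed_segment_eq_real_ivl)
      ultimately show ?thesis using side[of b b'] by simp
    qed
    moreover have "norm (contour_integral (linepath b' a) ?g) \<le> 2 * C / R\<^sup>2 * R"
    proof -
      have "norm (a - b') = R" using R0 by (simp add: b'_def a_def b_def cmod_def)
      moreover have "0 \<le> Im z \<and> R \<le> norm z" if "z \<in> closed_segment b' a" for z
        using that R0 abs_Re_le_cmod[of z]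
        by (auto simp: b'_def a_def b_def closed_segment_same_Re closed_segment_eq_real_ivl)
      ultimately show ?thesis using side[of b' a] by simp
    qed
    \<comment> \<open>The sides have lengths R, 2 R and R, which accounts for the constant
      8.\<close>
    moreover have "2 * C / R\<^sup>2 * R + 2 * C / R\<^sup>2 * (2 * R) + 2 * C / R\<^sup>2 * R = 8 * C / R"
      using R0 by (simp add: power2_eq_square field_simps)
    moreover have "norm (v - (v + p + q + t)) \<le> norm p + norm q + norm t" for v p q t :: complex
      using norm_triangle_ineq[of "p + q" t] norm_triangle_ineq[of p q]
        norm_minus_cancel[of "p + q + t"] by (simp add: algebra_simps)
    ultimately show ?thesis
      by (smt (verit, best))
  qed
  have "(\<lambda>n. integral {- real n..real n} (\<lambda>x. ?g (of_real x))) \<longlonglongrightarrow> V"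
  proof (rule LIM_zero_cancel, rule Lim_null_comparison)
    show "\<forall>\<^sub>F n in sequentially. norm (integral {- real n..real n} (\<lambda>x. ?g (of_real x)) - V) \<le> 8 * C / real n"
      using eventually_ge_at_top[of "nat \<lceil>R1\<rceil>"] by eventually_elim (rule rect, linarith)
    show "(\<lambda>n. 8 * C / real n) \<longlonglongrightarrow> 0" by real_asymp
  qed
  with tendsto_integral_symmetric_intervals[OF int]
  show "(\<integral>x. ?g (of_real x) \<partial>lborel) = (if 0 < Im c then 2 * pi * \<i> * H c else 0)"
    unfolding V_def by (rule LIMSEQ_unique)
qed

text \<open>For real x, conjugating 1 / (x - cnj c) gives 1 / (x - c). Subtracting the conjugate of
  the vanishing integral at \<open>cnj c\<close> from the integral at \<open>c\<close> therefore
  keeps the value 2 pi i H(c) and replaces H by H - cnj H = 2 i Im H under the integral.\<close>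

lemma half_plane_boundary_density:
  fixes H :: "complex \<Rightarrow> complex"
  assumes \<delta>: "0 < \<delta>" and hol: "H holomorphic_on {z. - \<delta> < Im z}"
    and decay: "\<forall>z. 0 \<le> Im z \<longrightarrow> R0 \<le> norm z \<longrightarrow> norm (H z) \<le> C / norm z"
  defines "p \<equiv> \<lambda>x. - Im (H (complex_of_real x)) / pi"
  shows integrable_boundary_density:
      "0 < Im c \<Longrightarrow> integrable lborel (\<lambda>x. of_real (p x) / (c - of_real x))"
    and integral_boundary_density:
      "0 < Im c \<Longrightarrow> (\<integral>x. of_real (p x) / (c - of_real x) \<partial>lborel) = H c"
proof -
  assume c: "0 < Im c"
  define g where "g = (\<lambda>b x. H (of_real x) / (of_real x - b))"
  have 1: "integrable lborel (g c)" "(\<integral>x. g c x \<partial>lborel) = 2 * pi * \<i> * H c"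
    using half_plane_Cauchy_integral[OF \<delta> hol decay, of c] c by (auto simp: g_def)
  have 2: "integrable lborel (g (cnj c))" "(\<integral>x. g (cnj c) x \<partial>lborel) = 0"
    using half_plane_Cauchy_integral[OF \<delta> hol decay, of "cnj c"] c by (auto simp: g_def)
  have eq: "of_real (p x) / (c - of_real x) = (g c x - cnj (g (cnj c) x)) / (2 * pi * \<i>)" for x
  proof -
    have "g c x - cnj (g (cnj c) x) = 2 * \<i> * of_real (Im (H (of_real x))) / (of_real x - c)"
      by (simp add: g_def diff_divide_distrib [symmetric] complex_diff_cnj)
    then have "(g c x - cnj (g (cnj c) x)) / (2 * pi * \<i>) = of_real (Im (H (of_real x))) / pi / (of_real x - c)"
      by simp
    also have "\<dots> = of_real (p x) / (c - of_real x)"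
      using minus_divide_divide[of "of_real (Im (H (of_real x))) / pi" "of_real x - c"] by (simp add: p_def)
    finally show ?thesis ..
  qed
  show "integrable lborel (\<lambda>x. of_real (p x) / (c - of_real x))"
    unfolding eq using 1(1) 2(1) by simp
  show "(\<integral>x. of_real (p x) / (c - of_real x) \<partial>lborel) = H c"
    unfolding eq using 1 2 by simp
qed

text \<open>Taking real parts of c H(c) at c = i \<eta> integrates the density against a
  Poisson-type kernel \<open>k\<close>. This kernel increases to 1 with \<eta>, so monotone
  convergence identifies the total mass; its smallness away from the origin controls the tails,
  which is what tightness needs.\<close>

lemma half_plane_boundary_mass:
  fixes H :: "complex \<Rightarrow> complex"
  assumes \<delta>: "0 < \<delta>" and hol: "H holomorphic_on {z. - \<delta> < Im z}"
    and decay: "\<forall>z. 0 \<le> Im z \<longrightarrow> R0 \<le> norm z \<longrightarrow> norm (H z) \<le> C / norm z"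
    and nonpos: "\<And>x. Im (H (complex_of_real x)) \<le> 0"
    and lim: "(\<lambda>n. Re (\<i> * of_nat n * H (\<i> * of_nat n))) \<longlonglongrightarrow> 1"
  defines "p \<equiv> \<lambda>x. - Im (H (complex_of_real x)) / pi"
  shows integrable_boundary_mass: "integrable lborel p"
    and integral_boundary_mass: "(\<integral>x. p x \<partial>lborel) = 1"
    and boundary_mass_concentration: "\<And>\<eta>. 0 < \<eta> \<Longrightarrow>
      2 * Re (\<i> * of_real \<eta> * H (\<i> * of_real \<eta>)) - 1 \<le> (\<integral>x. indicator {-\<eta>..\<eta>} x * p x \<partial>lborel)"
proof -
  \<comment> \<open>the real part of \<open>c / (c - x)\<close> at \<open>c = \<i> * \<eta>\<close>\<close>
  define k where "k \<eta> x = \<eta>\<^sup>2 / (\<eta>\<^sup>2 + x\<^sup>2)" for \<eta> x :: real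
  have p0: "0 \<le> p x" for x using nonpos[of x] by (simp add: p_def divide_nonpos_pos)
  have Poisson: "integrable lborel (\<lambda>x. p x * k \<eta> x)"
      "(\<integral>x. p x * k \<eta> x \<partial>lborel) = Re (\<i> * of_real \<eta> * H (\<i> * of_real \<eta>))" if \<eta>: "0 < \<eta>" for \<eta>
  proof -
    let ?c = "\<i> * complex_of_real \<eta>"
    have ReC: "p x * k \<eta> x = Re (?c * (of_real (p x) / (?c - of_real x)))" for x
      using \<eta> by (simp add: k_def Re_divide power2_eq_square Im_divide algebra_simps)
    have intc: "integrable lborel (\<lambda>x. ?c * (of_real (p x) / (?c - of_real x)))"
      unfolding p_def using integrable_boundary_density[OF \<delta> hol decay, of ?c] \<eta>
      by (intro integrable_mult_right) auto
    have int: "(\<integral>x. ?c * (of_real (p x) / (?c - of_real x)) \<partial>lborel) = ?c * H ?c"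
      unfolding p_def using integral_boundary_density[OF \<delta> hol decay, of ?c] \<eta>
      by (subst integral_mult_right_zero) auto
    show "integrable lborel (\<lambda>x. p x * k \<eta> x)"
      unfolding ReC using intc by (rule integrable_Re)
    show "(\<integral>x. p x * k \<eta> x \<partial>lborel) = Re (?c * H ?c)"
      unfolding ReC int[symmetric] using intc by (rule integral_Re)
  qed
  have contp: "continuous_on UNIV p"
  proof -
    have "continuous_on {z. - \<delta> < Im z} H"
      using hol by (rule holomorphic_on_imp_continuous_on)
    then show ?thesis
      unfolding p_def using \<delta> by (intro continuous_intros continuous_on_compose2[where f=complex_of_real]) auto
  qed
  \<comment> \<open>The case m = 0 is separate: there the kernel is identically 0, at x = 0 by the
    convention 0 / 0 = 0.\<close>
  have mono: "k (real m) x \<le> k (real n) x" if "m \<le> n" for m n x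
  proof (cases "m = 0")
    case False
    have "k (real m) x = 1 - x\<^sup>2 / ((real m)\<^sup>2 + x\<^sup>2)" "k (real n) x = 1 - x\<^sup>2 / ((real n)\<^sup>2 + x\<^sup>2)"
      using False that by (auto simp: k_def field_simps add_pos_nonneg)
    moreover have "x\<^sup>2 / ((real n)\<^sup>2 + x\<^sup>2) \<le> x\<^sup>2 / ((real m)\<^sup>2 + x\<^sup>2)"
      using False that by (intro frac_le) (auto intro: add_pos_nonneg)
    ultimately show ?thesis by simp
  qed (simp add: k_def)
  have limk: "(\<lambda>n. k (real n) x) \<longlonglongrightarrow> 1" for x
    unfolding k_def by real_asymp
  have "has_bochner_integral lborel p 1"
  proof (rule has_bochner_integral_monotone_convergence)
    show "integrable lborel (\<lambda>x. p x * k (real n) x)" for n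
      using Poisson(1)[of "real n"] by (cases "n = 0") (auto simp: k_def)
    show "AE x in lborel. mono (\<lambda>n. p x * k (real n) x)"
      using mono p0 by (intro always_eventually allI monoI mult_left_mono)
    show "AE x in lborel. (\<lambda>n. p x * k (real n) x) \<longlonglongrightarrow> p x"
      using tendsto_mult[OF tendsto_const limk] by (intro always_eventually allI) fastforce
    have "\<forall>\<^sub>F n in sequentially. (\<integral>x. p x * k (real n) x \<partial>lborel) = Re (\<i> * of_nat n * H (\<i> * of_nat n))"
      using eventually_gt_at_top[of 0] by eventually_elim (simp add: Poisson(2))
    then show "(\<lambda>n. \<integral>x. p x * k (real n) x \<partial>lborel) \<longlonglongrightarrow> 1"
      using lim by (simp add: tendsto_cong)
  qed (use contp in \<open>simp add: borel_measurable_continuous_onI\<close>)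
  then show int: "integrable lborel p" and mass: "(\<integral>x. p x \<partial>lborel) = 1"
    by (auto simp: has_bochner_integral_iff)
  fix \<eta> :: real assume \<eta>: "0 < \<eta>"
  have int_ind: "integrable lborel (\<lambda>x. indicator {-\<eta>..\<eta>} x * p x)"
    using int integrable_mult_indicator[of "{-\<eta>..\<eta>}" lborel p] by simp
  \<comment> \<open>The kernel is at most 1 on [-\<eta>, \<eta>] and at most 1/2 outside, hence at
    most (1 + indicator) / 2. Since \<open>p\<close> has mass 1, solving for the indicator integral
    gives the bound.\<close>
  have "(\<integral>x. p x * k \<eta> x \<partial>lborel) \<le> (\<integral>x. (p x + indicator {-\<eta>..\<eta>} x * p x) / 2 \<partial>lborel)"
  proof (rule integral_mono)
    show "p x * k \<eta> x \<le> (p x + indicator {-\<eta>..\<eta>} x * p x) / 2" for x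
    proof (cases "x \<in> {-\<eta>..\<eta>}")
      case True
      have "k \<eta> x \<le> 1" using \<eta> by (simp add: k_def field_simps add_pos_nonneg)
      then show ?thesis using mult_left_mono[OF _ p0, of "k \<eta> x" 1 x] True by simp
    next
      case False
      then have "\<eta> \<le> \<bar>x\<bar>" by auto
      then have "\<eta>\<^sup>2 \<le> x\<^sup>2" using \<eta> power_mono[of \<eta> "\<bar>x\<bar>" 2] by simp
      then have "k \<eta> x \<le> 1 / 2" using \<eta> by (simp add: k_def field_simps add_pos_nonneg)
      then show ?thesis using mult_left_mono[OF _ p0, of "k \<eta> x" "1/2" x] False by simp
    qed
  qed (use Poisson(1)[OF \<eta>] int int_ind in auto)
  also have "\<dots> = (1 + (\<integral>x. indicator {-\<eta>..\<eta>} x * p x \<partial>lborel)) / 2"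
    using int int_ind mass by simp
  finally show "2 * Re (\<i> * of_real \<eta> * H (\<i> * of_real \<eta>)) - 1 \<le> (\<integral>x. indicator {-\<eta>..\<eta>} x * p x \<partial>lborel)"
    using Poisson(2)[OF \<eta>] by simp
qed

section \<open>Representation of a normalised map into the closed lower half-plane\<close>

theorem Cauchy_transform_of_nonpositive_Im:
  fixes F :: "complex \<Rightarrow> complex"
  assumes hol: "F holomorphic_on {z. 0 < Im z}"
    and neg: "\<And>z. 0 < Im z \<Longrightarrow> Im (F z) \<le> 0"
    and lim: "((\<lambda>z. z * F z) \<longlongrightarrow> 1) (inf at_infinity (principal {z. 0 < Im z}))"
  shows "\<exists>\<mu> :: real measure. prob_space \<mu> \<and> sets \<mu> = sets borel \<and>
            (\<forall>z. 0 < Im z \<longrightarrow> integrable \<mu> (\<lambda>x. 1 / (z - of_real x)) \<and>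
               F z = (\<integral>x. 1 / (z - of_real x) \<partial>\<mu>))"
proof -
  have near: "\<exists>R>0. \<forall>z. 0 < Im z \<longrightarrow> R \<le> norm z \<longrightarrow> norm (z * F z - 1) < e" if "0 < e" for e
  proof -
    have "\<forall>\<^sub>F z in inf at_infinity (principal {z. 0 < Im z}). dist (z * F z) 1 < e"
      using lim that by (rule tendstoD)
    then obtain b where "\<And>z. 0 < Im z \<Longrightarrow> b \<le> norm z \<Longrightarrow> norm (z * F z - 1) < e"
      by (auto simp: eventually_inf_principal eventually_at_infinity dist_norm)
    then show ?thesis by (intro exI[of _ "max b 1"]) auto
  qed
  define \<delta> where "\<delta> n = 1 / real (Suc n)" for n
  have \<delta>: "0 < \<delta> n" "\<delta> n \<le> 1" for n by (auto simp: \<delta>_def)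
  define H where "H n z = F (z + \<i> * of_real (\<delta> n))" for n z
  define p where "p n x = - Im (H n (complex_of_real x)) / pi" for n x
  obtain R0 where R0: "0 < R0" "\<And>z. 0 < Im z \<Longrightarrow> R0 \<le> norm z \<Longrightarrow> norm (z * F z - 1) < 1"
    using near[of 1] by auto
  have holH: "H n holomorphic_on {z. - \<delta> n < Im z}" for n
    unfolding H_def by (intro holomorphic_on_compose_gen[OF _ hol, unfolded o_def] holomorphic_intros) auto
  have decay: "\<forall>z. 0 \<le> Im z \<longrightarrow> R0 \<le> norm z \<longrightarrow> norm (H n z) \<le> 2 / norm z" for n
  proof (intro allI impI)
    fix z assume z: "0 \<le> Im z" "R0 \<le> norm z"
    define w where "w = z + \<i> * of_real (\<delta> n)"
    \<comment> \<open>Moving upwards from a point of the closed upper half-plane cannot decrease the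
      modulus, so \<open>R0\<close> and the constant 2 serve for every n.\<close>
    have "norm z \<le> norm w"
      using z(1) \<delta>[of n] by (auto simp: w_def cmod_def intro!: real_sqrt_le_mono power_mono)
    moreover have "norm (w * F w) \<le> 2"
      using R0(2)[of w] z \<delta>[of n] \<open>norm z \<le> norm w\<close> norm_triangle_ineq2[of "w * F w" 1] by (auto simp: w_def)
    ultimately have "norm (F w) * norm z \<le> 2"
      by (smt (verit, best) mult.commute mult_left_mono norm_ge_zero norm_mult)
    then show "norm (H n z) \<le> 2 / norm z"
      using z R0(1) pos_le_divide_eq[of "norm z" "norm (H n z)" 2] unfolding H_def w_def by linarith
  qed
  have nonpos: "Im (H n (of_real x)) \<le> 0" for n x
    unfolding H_def using \<delta> by (intro neg) auto
  \<comment> \<open>The threshold \<open>K\<close> must not depend on n: this uniformity is what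
    makes the family of measures tight.\<close>
  have approx: "\<exists>K>0. \<forall>n. \<forall>\<eta>\<ge>K. norm (\<i> * of_real \<eta> * H n (\<i> * of_real \<eta>) - 1) < e" if "0 < e" for e
  proof -
    obtain R where R: "0 < R" "\<And>z. 0 < Im z \<Longrightarrow> R \<le> norm z \<Longrightarrow> norm (z * F z - 1) < min 1 (e / 2)"
      using near[of "min 1 (e/2)"] \<open>0 < e\<close> by auto
    \<comment> \<open>As i \<eta> = w - i \<open>\<delta> n\<close>, the error splits into w F(w) -
      1, below e/2, and a term of size at most 2 / \<eta>, which \<open>5 / e\<close> pushes below
      e/2 as well.\<close>
    define K where "K = max R (5 / e)"
    have "norm (\<i> * of_real \<eta> * H n (\<i> * of_real \<eta>) - 1) < e" if \<eta>: "K \<le> \<eta>" for n \<eta>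
    proof -
      have pos: "R \<le> \<eta>" "0 < \<eta>" "5 / e \<le> \<eta>" using \<eta> R(1) by (auto simp: K_def)
      define w where "w = \<i> * of_real (\<eta> + \<delta> n)"
      have nw: "norm w = \<eta> + \<delta> n" using pos \<delta>[of n] by (simp add: w_def norm_mult del: of_real_add)
      have wF: "norm (w * F w - 1) < min 1 (e / 2)"
        using R(2)[of w] pos \<delta>[of n] nw by (simp add: w_def)
      then have "norm (w * F w) \<le> 2" using norm_triangle_ineq2[of "w * F w" 1] by auto
      then have "norm (F w) \<le> 2 / (\<eta> + \<delta> n)"
        using pos \<delta>[of n] by (simp add: norm_mult nw field_simps)
      then have Fw: "norm (F w) \<le> 2 / \<eta>"
        using pos \<delta>[of n] divide_left_mono[of "\<eta>" "\<eta> + \<delta> n" 2] by fastforce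
      have "2 / \<eta> < e / 2" using pos that \<open>0 < e\<close> by (simp add: field_simps)
      have "\<i> * of_real \<eta> * H n (\<i> * of_real \<eta>) - 1 = (w * F w - 1) - \<i> * of_real (\<delta> n) * F w"
        by (simp add: H_def w_def algebra_simps)
      also have "norm \<dots> \<le> norm (w * F w - 1) + \<delta> n * norm (F w)"
        using norm_triangle_ineq4[of "w * F w - 1" "\<i> * of_real (\<delta> n) * F w"] \<delta>[of n] by (simp add: norm_mult)
      also have "\<dots> \<le> norm (w * F w - 1) + 1 * (2 / \<eta>)"
        using \<delta>[of n] Fw by (intro add_left_mono mult_mono) auto
      also have "\<dots> < e" using wF \<open>2 / \<eta> < e / 2\<close> by simp
      finally show ?thesis .
    qed
    then show ?thesis using R(1) by (intro exI[of _ K]) (auto simp: K_def)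
  qed
  have limH: "(\<lambda>k. Re (\<i> * of_nat k * H n (\<i> * of_nat k))) \<longlonglongrightarrow> 1" for n
  proof -
    have "(\<lambda>k. \<i> * of_nat k * H n (\<i> * of_nat k)) \<longlonglongrightarrow> 1"
    proof (rule LIMSEQ_I)
      fix e :: real assume "0 < e"
      from approx[OF this] obtain K where
        K: "\<And>\<eta>. K \<le> \<eta> \<Longrightarrow> norm (\<i> * of_real \<eta> * H n (\<i> * of_real \<eta>) - 1) < e" by auto
      have "norm (\<i> * of_nat k * H n (\<i> * of_nat k) - 1) < e" if "nat \<lceil>K\<rceil> \<le> k" for k
        using K[of "real k"] that by simp
      then show "\<exists>N. \<forall>k\<ge>N. norm (\<i> * of_nat k * H n (\<i> * of_nat k) - 1) < e" by blast
    qed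
    from tendsto_Re[OF this] show ?thesis by simp
  qed
  note H_facts = \<delta>(1) holH decay
  have intp: "integrable lborel (p n)" and massp: "(\<integral>x. p n x \<partial>lborel) = 1" for n
    using integrable_boundary_mass[OF H_facts nonpos limH] integral_boundary_mass[OF H_facts nonpos limH]
    unfolding p_def by blast+
  have p0: "0 \<le> p n x" for n x using nonpos[of n x] by (simp add: p_def divide_nonpos_pos)
  have [measurable]: "p n \<in> borel_measurable borel" for n using intp[of n] by auto
  define \<mu> where "\<mu> n = density lborel (p n)" for n
  have sets_\<mu> [simp]: "sets (\<mu> n) = sets borel" "space (\<mu> n) = UNIV" for n by (auto simp: \<mu>_def)
  have dist: "real_distribution (\<mu> n)" for n
  proof (intro real_distribution.intro real_distribution_axioms.intro prob_spaceI)
    show "emeasure (\<mu> n) (space (\<mu> n)) = 1"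
      using intp[of n] massp[of n] p0[of n] by (simp add: \<mu>_def emeasure_density nn_integral_eq_integral)
  qed simp
  have tight: "tight \<mu>"
    unfolding tight_def
  proof (intro conjI allI impI dist)
    fix e :: real assume "0 < e"
    \<comment> \<open>The concentration bound doubles the deviation from 1, hence the tolerance
      e/2.\<close>
    then obtain K where K: "0 < K" "\<And>n \<eta>. K \<le> \<eta> \<Longrightarrow> norm (\<i> * of_real \<eta> * H n (\<i> * of_real \<eta>) - 1) < e / 2"
      using approx[of "e / 2"] by auto
    \<comment> \<open>Tightness is phrased with intervals open on the left; the left end moves to
      -K-1 so that [-K, K] is contained.\<close>
    have "1 - e < measure (\<mu> n) {-K-1<..K}" for n
    proof -
      interpret real_distribution "\<mu> n" by (rule dist)
      have "1 - e / 2 < Re (\<i> * of_real K * H n (\<i> * of_real K))"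
        using K(2)[of K n] abs_Re_le_cmod[of "\<i> * of_real K * H n (\<i> * of_real K) - 1"] by simp
      then have "1 - e < (\<integral>x. indicator {-K..K} x * p n x \<partial>lborel)"
        using boundary_mass_concentration[OF H_facts nonpos limH, of K n] K(1) unfolding p_def by linarith
      also have "\<dots> = measure (\<mu> n) {-K..K}"
      proof -
        have "measure (\<mu> n) {-K..K} = (\<integral>x. indicator {-K..K} x \<partial>\<mu> n)" by simp
        also have "\<dots> = (\<integral>x. indicator {-K..K} x * p n x \<partial>lborel)"
          unfolding \<mu>_def using p0 by (subst integral_density) (auto simp: mult.commute)
        finally show ?thesis by simp
      qed
      also have "\<dots> \<le> measure (\<mu> n) {-K-1<..K}"
        by (intro finite_measure_mono) auto
      finally show ?thesis .
    qed
    then show "\<exists>a b. a < b \<and> (\<forall>n. 1 - e < measure (\<mu> n) {a<..b})"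
      using K(1) by (intro exI[of _ "-K-1"] exI[of _ K]) auto
  qed
  obtain r M where r: "strict_mono r" and M: "real_distribution M" and conv: "weak_conv_m (\<mu> \<circ> id \<circ> r) M"
    using tight_imp_convergent_subsubsequence[OF tight strict_mono_id] by blast
  interpret M: real_distribution M by (rule M)
  have "integrable M (\<lambda>x. 1 / (z - of_real x)) \<and> F z = (\<integral>x. 1 / (z - of_real x) \<partial>M)" if z: "0 < Im z" for z
  proof
    have ne: "z - of_real x \<noteq> 0" for x using z by (auto simp: complex_eq_iff)
    \<comment> \<open>For fixed z the Cauchy kernel is thus bounded and continuous in x, so weak
      convergence carries its integrals to the limit measure.\<close>
    have bound: "norm (1 / (z - of_real x)) \<le> 1 / Im z" for x
      using abs_Im_le_cmod[of "z - of_real x"] z by (auto simp: norm_divide intro!: divide_left_mono mult_pos_pos ne)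
    have cont: "isCont (\<lambda>x. 1 / (z - complex_of_real x)) x" for x
      using ne by (intro continuous_intros) auto
    have [measurable]: "(\<lambda>x. 1 / (z - complex_of_real x)) \<in> borel_measurable borel" by measurable
    show "integrable M (\<lambda>x. 1 / (z - of_real x))"
      using bound by (intro M.integrable_const_bound[of _ "1 / Im z"]) auto
    have "(\<integral>x. 1 / (z - of_real x) \<partial>\<mu> n) = H n z" for n
    proof -
      have "(\<integral>x. 1 / (z - of_real x) \<partial>\<mu> n) = (\<integral>x. of_real (p n x) / (z - of_real x) \<partial>lborel)"
        unfolding \<mu>_def using p0 by (subst integral_density) (auto simp: scaleR_conv_of_real)
      also have "\<dots> = H n z"
        unfolding p_def by (rule integral_boundary_density[OF H_facts z])
      finally show ?thesis .
    qed
    moreover have "(\<lambda>n. \<integral>x. 1 / (z - of_real x) \<partial>(\<mu> \<circ> id \<circ> r) n) \<longlonglongrightarrow> (\<integral>x. 1 / (z - of_real x) \<partial>M)"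
      using dist M conv cont bound
      by (intro weak_conv_imp_integral_bdd_continuous_conv[where \<mu> = "\<mu> \<circ> id \<circ> r"]) auto
    ultimately have "(\<lambda>n. H (r n) z) \<longlonglongrightarrow> (\<integral>x. 1 / (z - of_real x) \<partial>M)" by simp
    moreover have "(\<lambda>n. H (r n) z) \<longlonglongrightarrow> F z"
    proof -
      have "\<delta> \<longlonglongrightarrow> 0" unfolding \<delta>_def by real_asymp
      from LIMSEQ_subseq_LIMSEQ[OF this r] have "(\<lambda>n. z + \<i> * of_real (\<delta> (r n))) \<longlonglongrightarrow> z + \<i> * of_real 0"
        by (intro tendsto_intros) (simp add: o_def)
      moreover have "isCont F z"
        using hol z holomorphic_on_imp_continuous_on continuous_on_eq_continuous_at open_halfspace_Im_gt by blast
      ultimately show ?thesis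
        unfolding H_def by (auto intro: isCont_tendsto_compose)
    qed
    ultimately show "F z = (\<integral>x. 1 / (z - of_real x) \<partial>M)" by (rule LIMSEQ_unique[symmetric])
  qed
  then show ?thesis using M.prob_space_axioms M.events_eq_borel by blast
qed

subsection \<open>Branches of powers and the gap function\<close>

lemma exp_log1: "w \<noteq> 0 \<Longrightarrow> exp (log1 w) = w"
  by (simp add: log1_def exp_add)

lemma log1_exp:
  assumes "0 < Im \<zeta>" "Im \<zeta> < 2 * pi"
  shows "log1 (exp \<zeta>) = \<zeta>"
proof -
  have "- exp \<zeta> = exp (\<zeta> - \<i> * of_real pi)"
    by (simp add: exp_diff)
  then show ?thesis
    using assms by (simp add: log1_def)
qed

lemma Im_log1:
  assumes "w \<notin> \<real>\<^sub>\<ge>\<^sub>0"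
  shows "0 < Im (log1 w)" "Im (log1 w) < 2 * pi"
proof -
  have "- w \<notin> \<real>\<^sub>\<le>\<^sub>0" "- w \<noteq> 0" using assms by auto
  then show "0 < Im (log1 w)" "Im (log1 w) < 2 * pi"
    using mpi_less_Im_Ln[of "- w"] Im_Ln_less_pi[of "- w"] by (auto simp: log1_def)
qed

lemma exp_notin_nonneg_Reals:
  assumes "0 < Im \<zeta>" "Im \<zeta> < 2 * pi"
  shows "exp \<zeta> \<notin> \<real>\<^sub>\<ge>\<^sub>0"
proof
  assume "exp \<zeta> \<in> \<real>\<^sub>\<ge>\<^sub>0"
  then have "Re (- exp \<zeta>) < 0" "Im (- exp \<zeta>) = 0"
    using exp_not_eq_zero[of \<zeta>] by (auto simp: complex_nonneg_Reals_iff complex_eq_iff simp del: exp_not_eq_zero)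
  \<comment> \<open>On the negative axis \<open>Ln\<close> has imaginary part pi, so
    \<open>log1\<close> would have imaginary part 2 pi, which the strip excludes.\<close>
  then have "Im (Ln (- exp \<zeta>)) = pi"
    by (subst Im_Ln_eq_pi) auto
  then show False
    using log1_exp[OF assms] assms(2) by (simp add: log1_def complex_eq_iff)
qed

lemma log1_eq_Ln: "0 < Im w \<Longrightarrow> log1 w = Ln w"
  using Ln_minus[of w] by (cases "w = 0") (auto simp: log1_def)

text \<open>Conjugation turns an argument t into -t; adding 2 pi brings it back to (0, 2 pi). This
  reflects statements about the upper half-plane in the line Im = pi.\<close>

lemma log1_cnj:
  assumes "w \<notin> \<real>\<^sub>\<ge>\<^sub>0"
  shows "log1 (cnj w) = cnj (log1 w) + 2 * of_real pi * \<i>"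
proof -
  have "w \<noteq> 0" using assms by auto
  then have "cnj w = cnj (exp (log1 w))" by (simp add: exp_log1)
  also have "\<dots> = exp (cnj (log1 w) + 2 * of_real pi * \<i>)" by (simp add: exp_add exp_cnj)
  finally show ?thesis
    using Im_log1[OF assms] log1_exp[of "cnj (log1 w) + 2 * of_real pi * \<i>"] by simp
qed

lemma holomorphic_on_log1: "log1 holomorphic_on - \<real>\<^sub>\<ge>\<^sub>0"
  unfolding log1_def [abs_def] by (auto intro!: holomorphic_intros)

lemma holomorphic_on_pow1 [holomorphic_intros]:
  assumes "g holomorphic_on S" "\<And>z. z \<in> S \<Longrightarrow> g z \<notin> \<real>\<^sub>\<ge>\<^sub>0"
  shows "(\<lambda>z. pow1 p (g z)) holomorphic_on S"
  unfolding pow1_def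
  using holomorphic_on_compose_gen[OF assms(1) holomorphic_on_log1] assms(2)
  by (auto intro!: holomorphic_intros simp: o_def)

lemma holomorphic_on_powP [holomorphic_intros]:
  assumes "g holomorphic_on S" "\<And>z. z \<in> S \<Longrightarrow> g z \<notin> \<real>\<^sub>\<le>\<^sub>0"
  shows "(\<lambda>z. powP q (g z)) holomorphic_on S"
  unfolding powP_def using assms by (auto intro!: holomorphic_intros)

lemma powP_of_real: "0 < x \<Longrightarrow> powP q (of_real x) = of_real (x powr q)"
  by (simp add: powP_def powr_def Ln_of_real exp_of_real flip: of_real_mult)

section \<open>The gap function: arguments, injectivity and behaviour at 0\<close>

text \<open>This is f of the overview: the numerator inside \<open>G_fun\<close>, with u in place of
  \<open>s * pow1 \<alpha> (- 1 / z)\<close>.\<close>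

definition root_gap :: "real \<Rightarrow> complex \<Rightarrow> complex" where
  "root_gap r u = 1 - powP (1 / r) (1 - u)"

lemma one_minus_notin_nonpos_Reals:
  fixes u :: complex
  shows "u \<notin> \<real>\<^sub>\<ge>\<^sub>0 \<Longrightarrow> 1 - u \<notin> \<real>\<^sub>\<le>\<^sub>0"
  by (auto simp: complex_nonneg_Reals_iff complex_nonpos_Reals_iff)

lemma root_gap_0 [simp]: "root_gap r 0 = 0"
  by (simp add: root_gap_def powP_def)

lemma root_gap_cnj:
  assumes "u \<notin> \<real>\<^sub>\<ge>\<^sub>0"
  shows "root_gap r (cnj u) = cnj (root_gap r u)"
  using cnj_Ln[OF one_minus_notin_nonpos_Reals[OF assms]] by (simp add: root_gap_def powP_def exp_cnj)

text \<open>The derivative stays in exponential form so that its argument can be read off as (1/r -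
  1) Im Ln(1 - u).\<close>

lemma root_gap_has_field_derivative:
  assumes "1 - u \<notin> \<real>\<^sub>\<le>\<^sub>0"
  shows "(root_gap r has_field_derivative of_real (1 / r) * exp (of_real (1 / r - 1) * Ln (1 - u))) (at u)"
proof -
  have ne: "1 - u \<noteq> 0" using assms by auto
  define q where "q = 1 / r"
  have "((\<lambda>u. 1 - exp (of_real q * Ln (1 - u))) has_field_derivative
      of_real q * exp (of_real (q - 1) * Ln (1 - u))) (at u)"
    using assms ne
    by (auto intro!: derivative_eq_intros simp: left_diff_distrib exp_diff divide_inverse)
  then show ?thesis
    by (simp add: root_gap_def [abs_def] powP_def q_def)
qed

text \<open>The point 1 - u has argument in (-pi, 0). Division by r >= 1 keeps it there, so the root
  lies in the lower half-plane.\<close>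

lemma Im_root_gap_pos:
  assumes r: "1 \<le> r" and u: "0 < Im u"
  shows "0 < Im (root_gap r u)"
proof -
  define l where "l = Ln (1 - u)"
  have l: "- pi < Im l" "Im l < 0"
    using u mpi_less_Im_Ln[of "1 - u"] Im_Ln_pos_le[of "1 - u"] Im_Ln_le_pi[of "1 - u"] unfolding l_def
    by (auto simp: complex_eq_iff)
  have "0 < - Im l / r" "- Im l / r < pi"
    using l r by (auto simp: field_simps) (smt (verit) mult_left_le_imp_le pi_gt_zero mult_le_cancel_left1)
  then have "0 < sin (- Im l / r)" by (rule sin_gt_zero)
  then have "sin (Im l / r) < 0" by simp
  then show ?thesis
    by (simp add: root_gap_def powP_def Im_exp mult_pos_neg flip: l_def)
qed

text \<open>Up to the factor |u|^2 this is Im(f(u) / u). Along the segment t u, the derivative of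
  f(t u) cnj(u) in t is f'(t u) |u|^2, and Im f' is nonnegative there.\<close>

lemma Im_root_gap_cnj_nonneg:
  assumes r: "1 \<le> r" and u: "0 < Im u"
  shows "0 \<le> Im (root_gap r u * cnj u)"
proof -
  define f' where "f' u = of_real (1 / r) * exp (of_real (1 / r - 1) * Ln (1 - u))" for u :: complex
  have "Im (root_gap r (of_real 0 * u) * cnj u) \<le> Im (root_gap r (of_real 1 * u) * cnj u)"
  proof (rule DERIV_nonneg_imp_nondecreasing[of 0 1])
    fix t :: real assume t: "0 \<le> t" "t \<le> 1"
    have notin: "1 - of_real t * u \<notin> \<real>\<^sub>\<le>\<^sub>0"
      using u t by (cases "t = 0") (auto simp: complex_nonpos_Reals_iff)
    have "((\<lambda>v. v * u) has_field_derivative u) (at (of_real t))"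
      by (auto intro!: derivative_eq_intros)
    from DERIV_cmult_right[OF DERIV_chain2[of "root_gap r", OF root_gap_has_field_derivative[OF notin] this]]
    have "((\<lambda>v. root_gap r (v * u) * cnj u) has_field_derivative f' (of_real t * u) * u * cnj u) (at (of_real t))"
      by (simp add: f'_def)
    then have "((\<lambda>t. Im (root_gap r (of_real t * u) * cnj u)) has_real_derivative Im (f' (of_real t * u) * u * cnj u)) (at t)"
      using has_field_derivative_Im has_vector_derivative_real_field by blast
    moreover have "0 \<le> Im (f' (of_real t * u) * u * cnj u)"
    proof -
      define l where "l = Ln (1 - of_real t * u)"
      have "1 - of_real t * u \<noteq> 0" "\<not> 0 < Im (1 - of_real t * u)"
        using notin u t by (auto simp: not_less)
      then have "- pi < Im l" "\<not> (0 < Im l \<and> Im l < pi)" "Im l < pi"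
        unfolding l_def using Im_Ln_pos_lt mpi_less_Im_Ln Im_Ln_less_pi[OF notin] by blast+
      then have l: "- pi < Im l" "Im l \<le> 0" by auto
      \<comment> \<open>The factor 1/r - 1 lies in (-1, 0] and Im l in (-pi, 0], so the argument of
        f' lies in [0, pi].\<close>
      have "0 \<le> (1 / r - 1) * Im l" using r l by (intro mult_nonpos_nonpos) auto
      moreover have "(1 / r - 1) * Im l \<le> pi"
      proof -
        have "(1 - 1 / r) * (- Im l) \<le> 1 * pi" using r l by (intro mult_mono) auto
        then show ?thesis by (simp add: algebra_simps)
      qed
      ultimately have "0 \<le> sin ((1 / r - 1) * Im l)" by (rule sin_ge_zero)
      then have "0 \<le> Im (f' (of_real t * u))"
        using r by (simp add: f'_def Im_exp flip: l_def)
      moreover have "Im (f' (of_real t * u) * u * cnj u) = Im (f' (of_real t * u)) * (norm u)\<^sup>2"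
        by (simp add: mult.assoc complex_norm_square [symmetric] flip: of_real_power)
      ultimately show ?thesis by simp
    qed
    ultimately show "\<exists>y. ((\<lambda>t. Im (root_gap r (of_real t * u) * cnj u)) has_real_derivative y) (at t) \<and> 0 \<le> y"
      by blast
  qed simp
  then show ?thesis by simp
qed

text \<open>Both arguments lie in (0, pi), so their difference lies in (-pi, pi); its sine is
  nonnegative, hence so is the difference.\<close>

lemma log1_root_gap_upper:
  assumes r: "1 \<le> r" and u: "0 < Im u"
  shows "Im (log1 u) \<le> Im (log1 (root_gap r u))" "Im (log1 (root_gap r u)) < pi"
proof -
  let ?f = "root_gap r u"
  have f: "0 < Im ?f" by (rule Im_root_gap_pos[OF assms])
  have a: "0 < Im (Ln u)" "Im (Ln u) < pi" and b: "0 < Im (Ln ?f)" "Im (Ln ?f) < pi"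
    using Im_Ln_pos_lt_imp u f by auto
  have "u \<noteq> 0" "?f \<noteq> 0" using u f by auto
  then have "?f * cnj u = exp (Ln ?f + cnj (Ln u))"
    by (simp add: exp_add flip: exp_cnj)
  then have "0 \<le> exp (Re (Ln ?f + cnj (Ln u))) * sin (Im (Ln ?f) - Im (Ln u))"
    using Im_root_gap_cnj_nonneg[OF assms] by (simp add: Im_exp)
  then have "0 \<le> sin (Im (Ln ?f) - Im (Ln u))" by (simp add: zero_le_mult_iff)
  then have "Im (Ln u) \<le> Im (Ln ?f)"
    using a b sin_gt_zero[of "Im (Ln u) - Im (Ln ?f)"] sin_minus[of "Im (Ln ?f) - Im (Ln u)"] by fastforce
  then show "Im (log1 u) \<le> Im (log1 ?f)" "Im (log1 ?f) < pi"
    using u f b by (auto simp: log1_eq_Ln)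
qed

text \<open>Arguments move towards pi without crossing it: above the axis by the preceding estimate,
  below it by reflection, while the negative axis is mapped into itself. Any sector with edges on
  either side of pi is therefore preserved.\<close>

lemma root_gap_in_sector:
  assumes r: "1 \<le> r" and ab: "0 \<le> a" "a \<le> pi" "pi \<le> b" "b \<le> 2 * pi"
    and \<zeta>: "a < Im \<zeta>" "Im \<zeta> < b"
  shows "root_gap r (exp \<zeta>) \<notin> \<real>\<^sub>\<ge>\<^sub>0"
    and "a < Im (log1 (root_gap r (exp \<zeta>)))" "Im (log1 (root_gap r (exp \<zeta>))) < b"
proof -
  let ?u = "exp \<zeta>"
  have lu: "log1 ?u = \<zeta>" using ab \<zeta> by (intro log1_exp) auto
  have u: "?u \<notin> \<real>\<^sub>\<ge>\<^sub>0" using ab \<zeta> by (intro exp_notin_nonneg_Reals) auto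
  have "root_gap r ?u \<notin> \<real>\<^sub>\<ge>\<^sub>0 \<and> a < Im (log1 (root_gap r ?u)) \<and> Im (log1 (root_gap r ?u)) < b"
  proof (cases "Im ?u" "0::real" rule: linorder_cases)
    case greater
    then show ?thesis
      using Im_root_gap_pos[OF r greater] log1_root_gap_upper[OF r greater] lu ab \<zeta>
      by (auto simp: complex_nonneg_Reals_iff)
  next
    case less
    define v where "v = cnj ?u"
    have v: "0 < Im v" "v \<notin> \<real>\<^sub>\<ge>\<^sub>0" using less u by (auto simp: v_def complex_nonneg_Reals_iff)
    have f: "0 < Im (root_gap r v)" by (rule Im_root_gap_pos[OF r v(1)])
    have "root_gap r ?u = cnj (root_gap r v)" using root_gap_cnj[OF v(2)] by (simp add: v_def)
    moreover have "log1 ?u = cnj (log1 v) + 2 * of_real pi * \<i>" using log1_cnj[OF v(2)] by (simp add: v_def)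
    moreover have "log1 (cnj (root_gap r v)) = cnj (log1 (root_gap r v)) + 2 * of_real pi * \<i>"
      using f by (intro log1_cnj) (auto simp: complex_nonneg_Reals_iff)
    ultimately show ?thesis
      using f log1_root_gap_upper[OF r v(1)] lu ab \<zeta> by (auto simp: complex_nonneg_Reals_iff)
  next
    case equal
    then have neg: "Re ?u < 0" using u by (auto simp: complex_nonneg_Reals_iff)
    define t where "t = - Re ?u"
    have ut: "?u = - of_real t" "0 < t" using equal neg by (auto simp: t_def complex_eq_iff)
    have "\<zeta> = Ln (of_real t) + \<i> * of_real pi" using lu ut by (simp add: log1_def)
    then have Im\<zeta>: "Im \<zeta> = pi" using ut(2) by (simp add: Ln_of_real)
    define q where "q = (1 + t) powr (1 / r) - 1"
    have q: "0 < q" using r ut(2) by (simp add: q_def)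
    have "1 - ?u = of_real (1 + t)" using ut(1) by simp
    then have f: "root_gap r ?u = - of_real q"
      using ut(2) by (simp add: root_gap_def powP_of_real q_def del: of_real_add)
    have "Im (log1 (- of_real q)) = pi" using q by (simp add: log1_def Ln_of_real)
    then show ?thesis using q Im\<zeta> \<zeta> unfolding f by (auto simp: complex_nonneg_Reals_iff)
  qed
  then show "root_gap r (exp \<zeta>) \<notin> \<real>\<^sub>\<ge>\<^sub>0" "a < Im (log1 (root_gap r (exp \<zeta>)))" "Im (log1 (root_gap r (exp \<zeta>))) < b"
    by blast+
qed

text \<open>Dividing Ln(1 - u) by r >= 1 leaves its imaginary part in (-pi, pi), where
  \<open>Ln\<close> undoes the exponential.\<close>

lemma inj_on_root_gap:
  assumes r: "1 \<le> r"
  shows "inj_on (root_gap r) (- \<real>\<^sub>\<ge>\<^sub>0)"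
proof (rule inj_onI)
  fix u v :: complex
  assume uv: "u \<in> - \<real>\<^sub>\<ge>\<^sub>0" "v \<in> - \<real>\<^sub>\<ge>\<^sub>0" and eq: "root_gap r u = root_gap r v"
  have *: "Ln (exp (of_real (1 / r) * Ln (1 - w))) = of_real (1 / r) * Ln (1 - w)" if "w \<in> - \<real>\<^sub>\<ge>\<^sub>0" for w
  proof (rule Ln_exp)
    have "1 - w \<notin> \<real>\<^sub>\<le>\<^sub>0" "1 - w \<noteq> 0" using that one_minus_notin_nonpos_Reals[of w] by auto
    then have "\<bar>Im (Ln (1 - w))\<bar> < pi" using mpi_less_Im_Ln[of "1 - w"] Im_Ln_less_pi[of "1 - w"] by auto
    moreover have "\<bar>Im (Ln (1 - w))\<bar> / r \<le> \<bar>Im (Ln (1 - w))\<bar> / 1"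
      using r by (intro divide_left_mono) auto
    ultimately have "\<bar>Im (Ln (1 - w)) / r\<bar> < pi" using r by simp
    then have "- pi < Im (Ln (1 - w)) / r" "Im (Ln (1 - w)) / r < pi" by linarith+
    then show "- pi < Im (of_real (1 / r) * Ln (1 - w))" "Im (of_real (1 / r) * Ln (1 - w)) \<le> pi"
      by simp_all
  qed
  have "exp (of_real (1 / r) * Ln (1 - u)) = exp (of_real (1 / r) * Ln (1 - v))"
    using eq by (simp add: root_gap_def powP_def)
  then have "of_real (1 / r) * Ln (1 - u) = of_real (1 / r) * Ln (1 - v)"
    using *[OF uv(1)] *[OF uv(2)] by metis
  then have "Ln (1 - u) = Ln (1 - v)" using r by simp
  moreover have "1 - u \<noteq> 0" "1 - v \<noteq> 0" using uv by auto
  ultimately have "1 - u = 1 - v" by (metis exp_Ln)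
  then show "u = v" by simp
qed

text \<open>This is the difference quotient of f at its zero 0, where the derivative is 1/r.\<close>

lemma root_gap_quotient_tendsto:
  assumes "1 \<le> r"
  shows "((\<lambda>u. root_gap r u / u) \<longlongrightarrow> of_real (1 / r)) (at 0)"
  using root_gap_has_field_derivative[of 0 r] by (simp add: has_field_derivative_iff)

subsection \<open>Strip coordinates\<close>

lemma admissible_sector:
  assumes "admissible \<alpha> s"
  shows "0 < \<alpha>" "s \<noteq> 0" "0 \<le> Arg s" "Arg s \<le> pi" "pi \<le> Arg s + \<alpha> * pi" "Arg s + \<alpha> * pi \<le> 2 * pi"
proof -
  have *: "Arg s \<le> 2 * pi - \<alpha> * pi \<and> 1 < \<alpha> \<and> 0 \<le> Arg s \<or> pi - \<alpha> * pi \<le> Arg s \<and> 0 < \<alpha> \<and> \<alpha> \<le> 1"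
    using assms by (auto simp: admissible_def algebra_simps)
  have **: "1 < \<alpha> \<Longrightarrow> pi \<le> \<alpha> * pi" "\<alpha> \<le> 1 \<Longrightarrow> \<alpha> * pi \<le> pi"
    using pi_gt_zero by (auto simp: mult_le_cancel_right1 mult_le_cancel_right2)
  show "0 < \<alpha>" "s \<noteq> 0" using assms by (auto simp: admissible_def)
  show "0 \<le> Arg s" "Arg s \<le> pi" "pi \<le> Arg s + \<alpha> * pi" "Arg s + \<alpha> * pi \<le> 2 * pi"
    using * ** Arg_le_pi[of s] by linarith+
qed

lemma Im_minus_inverse_pos: "0 < Im z \<Longrightarrow> 0 < Im (- 1 / z)"
  by (simp add: Im_divide sum_power2_gt_zero_iff)

locale G_parameters =
  fixes \<alpha> r :: real and s :: complex
  assumes r_ge_1: "1 \<le> r" and admissible: "admissible \<alpha> s"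
begin

lemmas sector = admissible_sector[OF admissible]

text \<open>A logarithm of \<open>s * pow1 \<alpha> (- 1 / z)\<close>. As -1/z is in the upper
  half-plane, \<open>Ln\<close> agrees with \<open>log1\<close> there.\<close>

definition \<zeta> :: "complex \<Rightarrow> complex" where
  "\<zeta> z = Ln s + of_real \<alpha> * Ln (- 1 / z)"

text \<open>The image of \<open>\<zeta> z\<close> under the strip map induced by f.\<close>

definition \<zeta>' :: "complex \<Rightarrow> complex" where
  "\<zeta>' z = log1 (root_gap r (exp (\<zeta> z)))"

lemma Im_\<zeta>:
  assumes "0 < Im z"
  shows "Arg s < Im (\<zeta> z)" "Im (\<zeta> z) < Arg s + \<alpha> * pi"
  using Im_Ln_pos_lt_imp[OF Im_minus_inverse_pos[OF assms]] sector(1,2)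
  by (auto simp: \<zeta>_def Arg_eq_Im_Ln)

lemma exp_\<zeta>:
  assumes "0 < Im z"
  shows "s * pow1 \<alpha> (- 1 / z) = exp (\<zeta> z)"
  using log1_eq_Ln[OF Im_minus_inverse_pos[OF assms]] sector(2) by (simp add: pow1_def \<zeta>_def exp_add)

lemma exp_\<zeta>_notin: "0 < Im z \<Longrightarrow> exp (\<zeta> z) \<notin> \<real>\<^sub>\<ge>\<^sub>0"
  using Im_\<zeta>[of z] sector by (intro exp_notin_nonneg_Reals) auto

lemma root_gap_exp_\<zeta>:
  assumes "0 < Im z"
  shows "root_gap r (exp (\<zeta> z)) \<notin> \<real>\<^sub>\<ge>\<^sub>0" "Arg s < Im (\<zeta>' z)" "Im (\<zeta>' z) < Arg s + \<alpha> * pi"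
  unfolding \<zeta>'_def using root_gap_in_sector[OF r_ge_1 sector(3-6) Im_\<zeta>[OF assms]] by auto

lemma root_gap_exp_\<zeta>_divide:
  assumes "0 < Im z"
  shows "root_gap r (exp (\<zeta> z)) / s = exp (\<zeta>' z - Ln s)"
proof -
  have "root_gap r (exp (\<zeta> z)) \<noteq> 0" using root_gap_exp_\<zeta>(1)[OF assms] by auto
  then show ?thesis using sector(2) by (simp add: \<zeta>'_def exp_log1 exp_diff)
qed

lemma root_gap_divide_notin:
  assumes "0 < Im z"
  shows "root_gap r (exp (\<zeta> z)) / s \<notin> \<real>\<^sub>\<ge>\<^sub>0"
  unfolding root_gap_exp_\<zeta>_divide[OF assms]
  using root_gap_exp_\<zeta>[OF assms] sector by (intro exp_notin_nonneg_Reals) (auto simp: Arg_eq_Im_Ln)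

lemma argument_notin_nonpos_Reals:
  assumes "0 < Im z"
  shows "1 - s * pow1 \<alpha> (- 1 / z) \<notin> \<real>\<^sub>\<le>\<^sub>0"
  unfolding exp_\<zeta>[OF assms] by (rule one_minus_notin_nonpos_Reals[OF exp_\<zeta>_notin[OF assms]])

lemma argument_notin_nonneg_Reals:
  assumes "0 < Im z"
  shows "(1 - powP (1 / r) (1 - s * pow1 \<alpha> (- 1 / z))) / s \<notin> \<real>\<^sub>\<ge>\<^sub>0"
  unfolding exp_\<zeta>[OF assms] by (rule root_gap_divide_notin[OF assms, unfolded root_gap_def])

lemma G_fun_eq_pow1:
  assumes "0 < Im z"
  shows "G_fun \<alpha> s r z = - of_real (r powr (1 / \<alpha>)) * pow1 (1 / \<alpha>) (root_gap r (exp (\<zeta> z)) / s)"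
  by (simp only: G_fun_def exp_\<zeta>[OF assms] root_gap_def)

text \<open>Subtracting Ln s shifts the strip to 0 < Im < \<alpha> pi, which lies within the range
  (0, 2 pi) of \<open>log1\<close>. The outer power thus becomes division by \<alpha>.\<close>

lemma G_fun_eq_exp:
  assumes "0 < Im z"
  shows "G_fun \<alpha> s r z = - of_real (r powr (1 / \<alpha>)) * exp ((\<zeta>' z - Ln s) / of_real \<alpha>)"
proof -
  have "log1 (exp (\<zeta>' z - Ln s)) = \<zeta>' z - Ln s"
    using root_gap_exp_\<zeta>[OF assms] sector by (intro log1_exp) (auto simp: Arg_eq_Im_Ln)
  then show ?thesis
    by (simp add: G_fun_eq_pow1[OF assms] root_gap_exp_\<zeta>_divide[OF assms] pow1_def)
qed

lemma Im_\<zeta>'_scaled: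
  assumes "0 < Im z"
  shows "0 < Im ((\<zeta>' z - Ln s) / of_real \<alpha>)" "Im ((\<zeta>' z - Ln s) / of_real \<alpha>) < pi"
  using root_gap_exp_\<zeta>[OF assms] sector by (auto simp: Arg_eq_Im_Ln field_simps)

lemma Im_G_fun_neg:
  assumes "0 < Im z"
  shows "Im (G_fun \<alpha> s r z) < 0"
proof -
  have "0 < Im (exp ((\<zeta>' z - Ln s) / of_real \<alpha>))"
    unfolding Im_exp using Im_\<zeta>'_scaled[OF assms] by (intro mult_pos_pos sin_gt_zero) auto
  then show ?thesis using r_ge_1 by (simp add: G_fun_eq_exp[OF assms])
qed

lemma holomorphic_G_fun: "G_fun \<alpha> s r holomorphic_on {z. 0 < Im z}"
proof -
  have up: "- 1 / z \<notin> \<real>\<^sub>\<ge>\<^sub>0" "z \<noteq> 0" if "0 < Im z" for z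
    using Im_minus_inverse_pos[OF that] that by (auto simp: complex_nonneg_Reals_iff)
  show ?thesis
    unfolding G_fun_def [abs_def]
    by (intro holomorphic_intros) (use up argument_notin_nonpos_Reals argument_notin_nonneg_Reals sector(2) in auto)
qed

text \<open>The layers are undone from the outside in. Each exponential is cancelled because its
  arguments lie in a strip of height at most 2 pi.\<close>

lemma inj_on_G_fun: "inj_on (G_fun \<alpha> s r) {z. 0 < Im z}"
proof (rule inj_onI, clarify)
  fix x y :: complex
  assume x: "0 < Im x" and y: "0 < Im y" and eq: "G_fun \<alpha> s r x = G_fun \<alpha> s r y"
  have exp1: "exp ((\<zeta>' x - Ln s) / of_real \<alpha>) = exp ((\<zeta>' y - Ln s) / of_real \<alpha>)"
    using eq r_ge_1 by (simp add: G_fun_eq_exp x y)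
  have "(\<zeta>' x - Ln s) / of_real \<alpha> = (\<zeta>' y - Ln s) / of_real \<alpha>"
    by (rule exp_complex_eqI[OF _ exp1]) (use Im_\<zeta>'_scaled[OF x] Im_\<zeta>'_scaled[OF y] in linarith)
  then have "\<zeta>' x = \<zeta>' y" using sector(1) by simp
  then have "exp (\<zeta>' x) = exp (\<zeta>' y)" by simp
  moreover have "exp (\<zeta>' z) = root_gap r (exp (\<zeta> z))" if "0 < Im z" for z
    using root_gap_exp_\<zeta>(1)[OF that] unfolding \<zeta>'_def by (intro exp_log1) auto
  ultimately have "root_gap r (exp (\<zeta> x)) = root_gap r (exp (\<zeta> y))" using x y by simp
  then have exp2: "exp (\<zeta> x) = exp (\<zeta> y)"
    using inj_onD[OF inj_on_root_gap[OF r_ge_1]] exp_\<zeta>_notin x y by blast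
  have "\<zeta> x = \<zeta> y"
    by (rule exp_complex_eqI[OF _ exp2]) (use Im_\<zeta>[OF x] Im_\<zeta>[OF y] sector in linarith)
  then have "Ln (- 1 / x) = Ln (- 1 / y)" using sector(1) by (simp add: \<zeta>_def)
  then have "- 1 / x = - 1 / y"
    using Im_minus_inverse_pos[OF x] Im_minus_inverse_pos[OF y] by (metis exp_Ln less_irrefl zero_complex.simps(2))
  then show "x = y" using x y by (auto simp: field_simps)
qed

text \<open>Expresses z G(z) through f(u) / u alone, so that only the limit of this quotient at u =
  0 is needed.\<close>

lemma times_G_fun:
  assumes "0 < Im z"
  shows "z * G_fun \<alpha> s r z =
    of_real (r powr (1 / \<alpha>)) * exp (Ln (root_gap r (exp (\<zeta> z)) / exp (\<zeta> z)) / of_real \<alpha>)"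
proof -
  have sec: "a < Im (\<zeta>' z) \<and> Im (\<zeta>' z) < b"
    if "0 \<le> a" "a \<le> pi" "pi \<le> b" "b \<le> 2 * pi" "a < Im (\<zeta> z)" "Im (\<zeta> z) < b" for a b
    unfolding \<zeta>'_def using root_gap_in_sector[OF r_ge_1 that] by auto
  \<comment> \<open>Three sectors are used, for Im below, above and equal to pi; each has width pi
    and contains both points. Hence the principal logarithm of the quotient is
    \<open>\<zeta>' z - \<zeta> z\<close>.\<close>
  have "\<bar>Im (\<zeta>' z) - Im (\<zeta> z)\<bar> < pi"
    using sec[of 0 pi] sec[of pi "2 * pi"] sec[of "pi / 2" "3 * pi / 2"] Im_\<zeta>[OF assms] sector pi_gt_zero
    by (cases "Im (\<zeta> z)" pi rule: linorder_cases) (auto simp: abs_if)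
  then have "Ln (exp (\<zeta>' z - \<zeta> z)) = \<zeta>' z - \<zeta> z"
    by (intro Ln_exp) auto
  moreover have "exp (\<zeta>' z - \<zeta> z) = root_gap r (exp (\<zeta> z)) / exp (\<zeta> z)"
    using root_gap_exp_\<zeta>(1)[OF assms] by (subst exp_diff, subst \<zeta>'_def, subst exp_log1) auto
  ultimately have L: "Ln (root_gap r (exp (\<zeta> z)) / exp (\<zeta> z)) = \<zeta>' z - \<zeta> z" by simp
  \<comment> \<open>Writing -z as an exponential cancels the Ln(-1/z) contained in
    \<open>\<zeta> z\<close> divided by \<alpha>.\<close>
  have "- 1 / z \<noteq> 0" using assms by auto
  then have minus_z: "- z = exp (- Ln (- 1 / z))" by (simp add: exp_minus)
  have "z * G_fun \<alpha> s r z = of_real (r powr (1 / \<alpha>)) * (- z * exp ((\<zeta>' z - Ln s) / of_real \<alpha>))"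
    by (simp add: G_fun_eq_exp[OF assms])
  also have "- z * exp ((\<zeta>' z - Ln s) / of_real \<alpha>) =
      exp (- Ln (- 1 / z)) * exp ((\<zeta>' z - Ln s) / of_real \<alpha>)"
    by (simp only: minus_z)
  also have "\<dots> = exp ((\<zeta>' z - \<zeta> z) / of_real \<alpha>)"
    using sector(1) by (simp add: \<zeta>_def diff_divide_distrib add_divide_distrib diff_diff_add flip: exp_add)
  finally show ?thesis by (simp add: L)
qed

text \<open>At infinity u = exp(\<open>\<zeta> z\<close>) has modulus |s| |z|^(-\<alpha>) and tends
  to 0, so f(u) / u tends to 1/r; the prefactor \<open>r powr (1 / \<alpha>)\<close> normalises the
  limit to 1.\<close>

lemma times_G_fun_tendsto:
  "((\<lambda>z. z * G_fun \<alpha> s r z) \<longlongrightarrow> 1) (inf at_infinity (principal {z. 0 < Im z}))"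
    (is "(_ \<longlongrightarrow> _) ?F")
proof -
  have up: "\<forall>\<^sub>F z in ?F. 0 < Im z"
    by (simp add: eventually_inf_principal)
  have "(inverse \<longlongrightarrow> (0 :: complex)) ?F"
    using tendsto_inverse_0 by (rule tendsto_mono[rotated]) simp
  then have "((\<lambda>z. norm s * norm (inverse z) powr \<alpha>) \<longlongrightarrow> norm s * 0) ?F"
    using sector(1) by (intro tendsto_intros tendsto_zero_powrI[where b = \<alpha>] tendsto_norm_zero) auto
  moreover have "\<forall>\<^sub>F z in ?F. norm s * norm (inverse z) powr \<alpha> = norm (exp (\<zeta> z))"
    using up
  proof eventually_elim
    case (elim z)
    then have "z \<noteq> 0" by auto
    then show ?case
      using sector(2) by (simp add: \<zeta>_def exp_add norm_mult powr_def norm_divide norm_inverse divide_inverse)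
  qed
  ultimately have "((\<lambda>z. norm (exp (\<zeta> z))) \<longlongrightarrow> 0) ?F"
    by (simp add: tendsto_cong)
  then have "((\<lambda>z. exp (\<zeta> z)) \<longlongrightarrow> 0) ?F"
    by (rule tendsto_norm_zero_cancel)
  \<comment> \<open>The punctured filter is legitimate because an exponential never
    vanishes.\<close>
  then have to_0: "filterlim (\<lambda>z. exp (\<zeta> z)) (at 0) ?F"
    by (simp add: filterlim_at)
  have not_nonpos: "complex_of_real (1 / r) \<notin> \<real>\<^sub>\<le>\<^sub>0"
    using r_ge_1 by (subst nonpos_Reals_of_real_iff) simp
  from filterlim_compose[OF root_gap_quotient_tendsto[OF r_ge_1] to_0]
  have "((\<lambda>z. of_real (r powr (1 / \<alpha>)) * exp (Ln (root_gap r (exp (\<zeta> z)) / exp (\<zeta> z)) / of_real \<alpha>))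
      \<longlongrightarrow> of_real (r powr (1 / \<alpha>)) * exp (Ln (of_real (1 / r)) / of_real \<alpha>)) ?F"
    using sector(1) not_nonpos by (intro tendsto_intros) (simp_all del: of_real_divide)
  also have "of_real (r powr (1 / \<alpha>)) * exp (Ln (of_real (1 / r)) / of_real \<alpha>) = (1 :: complex)"
  proof -
    have "Ln (of_real (1 / r)) = complex_of_real (- ln r)"
      using r_ge_1 Ln_of_real[of "1 / r"] by (simp add: ln_div)
    then have "exp (Ln (of_real (1 / r)) / of_real \<alpha>) = complex_of_real (exp (- ln r / \<alpha>))"
      by (simp only: exp_of_real flip: of_real_divide)
    moreover have "r powr (1 / \<alpha>) * exp (- ln r / \<alpha>) = 1"
      using r_ge_1 by (simp add: powr_def flip: exp_add)
    ultimately show ?thesis by (simp only: of_real_1 flip: of_real_mult)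
  qed
  finally show ?thesis
    by (rule tendsto_cong[THEN iffD1, rotated]) (use up times_G_fun in \<open>auto elim: eventually_mono\<close>)
qed

end

theorem theorem3p2:
  fixes \<alpha> r :: real and s :: complex
  assumes "1 \<le> r" and "admissible \<alpha> s"
  shows "(\<forall>z. 0 < Im z \<longrightarrow>
            \<not> (Im (1 - s * pow1 \<alpha> (- 1 / z)) = 0 \<and> Re (1 - s * pow1 \<alpha> (- 1 / z)) \<le> 0) \<and>
            \<not> (Im ((1 - powP (1 / r) (1 - s * pow1 \<alpha> (- 1 / z))) / s) = 0 \<and>
               0 \<le> Re ((1 - powP (1 / r) (1 - s * pow1 \<alpha> (- 1 / z))) / s)))
       \<and> G_fun \<alpha> s r analytic_on {z. 0 < Im z}
       \<and> (\<forall>z. 0 < Im z \<longrightarrow> Im (G_fun \<alpha> s r z) < 0)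
       \<and> inj_on (G_fun \<alpha> s r) {z. 0 < Im z}
       \<and> (\<exists>\<mu> :: real measure. prob_space \<mu> \<and> sets \<mu> = sets borel \<and>
            (\<forall>z. 0 < Im z \<longrightarrow>
               integrable \<mu> (\<lambda>x. 1 / (z - of_real x)) \<and>
               G_fun \<alpha> s r z = (\<integral>x. 1 / (z - of_real x) \<partial>\<mu>)))"
proof -
  interpret G_parameters \<alpha> r s using assms by unfold_locales
  show ?thesis
  proof (intro conjI)
    \<comment> \<open>The powers are total functions, so analyticity alone would not show that the
      bases avoid the branch cuts.\<close>
    have "1 - s * pow1 \<alpha> (- 1 / z) \<notin> \<real>\<^sub>\<le>\<^sub>0 \<and>
        (1 - powP (1 / r) (1 - s * pow1 \<alpha> (- 1 / z))) / s \<notin> \<real>\<^sub>\<ge>\<^sub>0" if "0 < Im z" for z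
      by (intro conjI argument_notin_nonpos_Reals argument_notin_nonneg_Reals that)
    then show "\<forall>z. 0 < Im z \<longrightarrow>
            \<not> (Im (1 - s * pow1 \<alpha> (- 1 / z)) = 0 \<and> Re (1 - s * pow1 \<alpha> (- 1 / z)) \<le> 0) \<and>
            \<not> (Im ((1 - powP (1 / r) (1 - s * pow1 \<alpha> (- 1 / z))) / s) = 0 \<and>
               0 \<le> Re ((1 - powP (1 / r) (1 - s * pow1 \<alpha> (- 1 / z))) / s))"
      unfolding complex_nonneg_Reals_iff complex_nonpos_Reals_iff by blast
    show "G_fun \<alpha> s r analytic_on {z. 0 < Im z}"
      using holomorphic_G_fun by (simp add: analytic_on_open open_halfspace_Im_gt)
    show "\<forall>z. 0 < Im z \<longrightarrow> Im (G_fun \<alpha> s r z) < 0"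
      using Im_G_fun_neg by blast
    show "inj_on (G_fun \<alpha> s r) {z. 0 < Im z}"
      by (rule inj_on_G_fun)
    show "\<exists>\<mu> :: real measure. prob_space \<mu> \<and> sets \<mu> = sets borel \<and>
            (\<forall>z. 0 < Im z \<longrightarrow> integrable \<mu> (\<lambda>x. 1 / (z - of_real x)) \<and>
               G_fun \<alpha> s r z = (\<integral>x. 1 / (z - of_real x) \<partial>\<mu>))"
      using holomorphic_G_fun less_imp_le[OF Im_G_fun_neg] times_G_fun_tendsto
      by (rule Cauchy_transform_of_nonpositive_Im)
  qed
qed

end
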